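(* Let $(\varepsilon_n)$ be a sequence of reals with $\varepsilon_n \to 0$. There exists $N$ such that the following holds for every odd $n \ge N$. Let $G$ be a $d$-regular graph on $V = [n]$ with $\lfloor 0.293 n \rfloor - 1 \le d \le (n-3)/2$, $|\mathrm{aut}(B_1(G))| = 1$, and $|B_1(u) \cap B_1(v)| = (1 + o(1)) d^2/n$ for every pair of vertices $u \ne v$, meaning $\bigl|\,|B_1(u)\cap B_1(v)| - d^2/n\,\bigr| \le \varepsilon_n d^2/n$. Then the graphic voting rule $\Phi_G$ is an odd, monotone, unbiased voting rule with $|\mathrm{aut}(\Phi_G)| = 1$. Moreover, $\Phi_G$ has winning coalitions of size $d+1$.
   Context: A voting rule on $n$ voters is a function $\Phi : \{-1,1\}^n \to \{-1,1\}$. It is odd if $\Phi(-x) = -\Phi(x)$ for all $x$, and monotone if $\Phi(x) \ge \Phi(x')$ whenever $x \ge x'$ coordinate-wise. A permutation $\sigma$ of $[n]$ acts on $\{-1,1\}^n$ by permuting coordinates, and on voting rules by $(\sigma\Phi)(x) = \Phi(\sigma^{-1}(x))$; $\mathrm{aut}(\Phi)$ is the group of permutations $\sigma$ with $\sigma\Phi = \Phi$. For $x \in \{-1,1\}^n$ let $x^{\oplus i}$ be $x$ with its $i$-th coordinate negated. For a probability measure $q$ on $\{-1,1\}^n$, $\mathbb{I}_i^q(\Phi) = \mathbb{P}_{x \sim q}[\Phi(x) \ne \Phi(x^{\oplus i})]$. $\Phi$ is unbiased if $\mathbb{I}_1^q(\Phi) = \cdots = \mathbb{I}_n^q(\Phi)$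 for every i.i.d. measure $q = p^{\otimes n}$, $p$ a probability measure on $\{-1,1\}$. A winning coalition for $\Phi$ is a set $S \subseteq [n]$ such that for each $y \in \{-1,1\}$, whenever $x_i = y$ for all $i \in S$, then $\Phi(x) = y$. For a (simple, undirected) graph $G$ on $V = [n]$ with graph distance $d(\cdot,\cdot)$, $B_r(v) = \{u \in V : d(u,v) \le r\}$ and $B_r(G) = \{B_r(v) : v \in V\}$. The radius is (non-standardly) defined as $\mathrm{rad}(G) = \lceil \mathrm{diam}(G)/2 \rceil$, so that any two balls of radius $\mathrm{rad}(G)$ intersect. For a permutation $\sigma$ of $V$, $\sigma(G)$ is the graph with edges $\{\sigma(u),\sigma(v)\}$ for edges $\{u,v\}$ of $G$, and $\mathrm{aut}(B_1(G))$ is the set of permutations $\sigma$ with $B_1(\sigma(G)) = B_1(G)$ (equality of sets of subsets of $V$). For $n$ odd and $r = \mathrm{rad}(G)$, the graphic voting rule $\Phi_G$ is defined by: $\Phi_G(x) = y$ if there exist $v \in V$ and $y \in \{-1,1\}$ with $x_i = y$ for all $i \in B_r(v)$, and $\Phi_G(x) = \mathrm{maj}_n(x)$ (the majority value among the coordinates of $x$) otherwise. *)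

theory Defs
  imports "HOL-Probability.Probability" "HOL-Combinatorics.Permutations"
begin

section \<open>Voting rules\<close>

text \<open>
  Points of the cube are functions on the naturals that are \<^const>\<open>undefined\<close> off the index
  set; voting rules are \<^const>\<open>undefined\<close> off the cube. Hence HOL equality of points, and of
  voting rules, is the intended equality.
\<close>

definition cube :: "nat \<Rightarrow> (nat \<Rightarrow> int) set" where
  "cube n = {1..n} \<rightarrow>\<^sub>E {-1, 1}"

definition voting_rules :: "nat \<Rightarrow> ((nat \<Rightarrow> int) \<Rightarrow> int) set" where
  "voting_rules n = cube n \<rightarrow>\<^sub>E {-1, 1}"

definition odd_rule :: "nat \<Rightarrow> ((nat \<Rightarrow> int) \<Rightarrow> int) \<Rightarrow> bool" where
  "odd_rule n \<Phi> \<longleftrightarrow> (\<forall>x\<in>cube n. \<Phi> (\<lambda>i\<in>{1..n}. - x i) = - \<Phi> x)"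

definition monotone_rule :: "nat \<Rightarrow> ((nat \<Rightarrow> int) \<Rightarrow> int) \<Rightarrow> bool" where
  "monotone_rule n \<Phi> \<longleftrightarrow>
     (\<forall>x\<in>cube n. \<forall>x'\<in>cube n. (\<forall>i\<in>{1..n}. x i \<ge> x' i) \<longrightarrow> \<Phi> x \<ge> \<Phi> x')"

definition permute_point :: "(nat \<Rightarrow> nat) \<Rightarrow> (nat \<Rightarrow> int) \<Rightarrow> (nat \<Rightarrow> int)" where
  "permute_point \<sigma> x = (\<lambda>i. x (inv \<sigma> i))"

definition permute_rule ::
    "nat \<Rightarrow> (nat \<Rightarrow> nat) \<Rightarrow> ((nat \<Rightarrow> int) \<Rightarrow> int) \<Rightarrow> ((nat \<Rightarrow> int) \<Rightarrow> int)" where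
  "permute_rule n \<sigma> \<Phi> = (\<lambda>x\<in>cube n. \<Phi> (permute_point (inv \<sigma>) x))"

definition aut_rule :: "nat \<Rightarrow> ((nat \<Rightarrow> int) \<Rightarrow> int) \<Rightarrow> (nat \<Rightarrow> nat) set" where
  "aut_rule n \<Phi> = {\<sigma>. \<sigma> permutes {1..n} \<and> permute_rule n \<sigma> \<Phi> = \<Phi>}"

definition flip :: "nat \<Rightarrow> (nat \<Rightarrow> int) \<Rightarrow> (nat \<Rightarrow> int)" where
  "flip i x = x(i := - x i)"

definition influence ::
    "(nat \<Rightarrow> int) pmf \<Rightarrow> nat \<Rightarrow> ((nat \<Rightarrow> int) \<Rightarrow> int) \<Rightarrow> real" where
  "influence q i \<Phi> = measure_pmf.prob q {x. \<Phi> x \<noteq> \<Phi> (flip i x)}"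

text \<open>The default value \<^const>\<open>undefined\<close> makes the product measure live on \<^const>\<open>cube\<close>.\<close>

definition iid :: "nat \<Rightarrow> int pmf \<Rightarrow> (nat \<Rightarrow> int) pmf" where
  "iid n p = Pi_pmf {1..n} undefined (\<lambda>_. p)"

definition unbiased :: "nat \<Rightarrow> ((nat \<Rightarrow> int) \<Rightarrow> int) \<Rightarrow> bool" where
  "unbiased n \<Phi> \<longleftrightarrow>
     (\<forall>p. set_pmf p \<subseteq> {-1, 1} \<longrightarrow>
        (\<forall>i\<in>{1..n}. \<forall>j\<in>{1..n}. influence (iid n p) i \<Phi> = influence (iid n p) j \<Phi>))"

definition winning_coalition :: "nat \<Rightarrow> ((nat \<Rightarrow> int) \<Rightarrow> int) \<Rightarrow> nat set \<Rightarrow> bool" where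
  "winning_coalition n \<Phi> S \<longleftrightarrow>
     S \<subseteq> {1..n} \<and> (\<forall>y\<in>{-1, 1}. \<forall>x\<in>cube n. (\<forall>i\<in>S. x i = y) \<longrightarrow> \<Phi> x = y)"

text \<open>Only meant for odd \<open>n\<close>, where ties do not occur.\<close>

definition maj :: "nat \<Rightarrow> (nat \<Rightarrow> int) \<Rightarrow> int" where
  "maj n x = (if card {i\<in>{1..n}. x i = 1} > card {i\<in>{1..n}. x i = -1} then 1 else -1)"

section \<open>Graphs\<close>

text \<open>A graph with vertex set \<open>{1..n}\<close> is given by its set of edges.\<close>

definition simple_graph :: "nat \<Rightarrow> nat set set \<Rightarrow> bool" where
  "simple_graph n E \<longleftrightarrow> (\<forall>e\<in>E. e \<subseteq> {1..n} \<and> card e = 2)"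

definition regular :: "nat \<Rightarrow> nat set set \<Rightarrow> nat \<Rightarrow> bool" where
  "regular n E d \<longleftrightarrow> (\<forall>v\<in>{1..n}. card {u\<in>{1..n}. {u, v} \<in> E} = d)"

text \<open>
  The length of a shortest walk; it is \<open>\<infinity>\<close>, the infimum of the empty set, if there is no walk.
\<close>

definition gdist :: "nat set set \<Rightarrow> nat \<Rightarrow> nat \<Rightarrow> enat" where
  "gdist E u v = (INF k\<in>{k. (u, v) \<in> {(a, b). {a, b} \<in> E} ^^ k}. enat k)"

definition gball :: "nat \<Rightarrow> nat set set \<Rightarrow> enat \<Rightarrow> nat \<Rightarrow> nat set" where
  "gball n E r v = {u\<in>{1..n}. gdist E u v \<le> r}"

definition gballs :: "nat \<Rightarrow> nat set set \<Rightarrow> enat \<Rightarrow> nat set set" where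
  "gballs n E r = gball n E r ` {1..n}"

definition gdiam :: "nat \<Rightarrow> nat set set \<Rightarrow> enat" where
  "gdiam n E = (SUP u\<in>{1..n}. SUP v\<in>{1..n}. gdist E u v)"

text \<open>Half the diameter rounded up, which is not the usual notion of the radius of a graph.\<close>

definition grad :: "nat \<Rightarrow> nat set set \<Rightarrow> enat" where
  "grad n E = (case gdiam n E of enat k \<Rightarrow> enat (nat \<lceil>real k / 2\<rceil>) | \<infinity> \<Rightarrow> \<infinity>)"

definition permute_graph :: "(nat \<Rightarrow> nat) \<Rightarrow> nat set set \<Rightarrow> nat set set" where
  "permute_graph \<sigma> E = (\<lambda>e. \<sigma> ` e) ` E"

definition aut_gballs :: "nat \<Rightarrow> nat set set \<Rightarrow> (nat \<Rightarrow> nat) set" where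
  "aut_gballs n E = {\<sigma>. \<sigma> permutes {1..n} \<and> gballs n (permute_graph \<sigma> E) 1 = gballs n E 1}"

definition ball_unanimous :: "nat \<Rightarrow> nat set set \<Rightarrow> (nat \<Rightarrow> int) \<Rightarrow> int \<Rightarrow> bool" where
  "ball_unanimous n E x y \<longleftrightarrow>
     y \<in> {-1, 1} \<and> (\<exists>v\<in>{1..n}. \<forall>i\<in>gball n E (grad n E) v. x i = y)"

text \<open>
  Any two balls of radius \<^const>\<open>grad\<close> intersect, so at most one value is unanimous on some ball.
\<close>

definition graphic_rule :: "nat \<Rightarrow> nat set set \<Rightarrow> ((nat \<Rightarrow> int) \<Rightarrow> int)" where
  "graphic_rule n E = (\<lambda>x\<in>cube n.
     if \<exists>y. ball_unanimous n E x y then (THE y. ball_unanimous n E x y) else maj n x)"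

end

theory Submission imports Defs begin

text \<open>
  For large \<open>n\<close> any two balls of radius 1 meet, so the radius is 1, and any two of them together
  cover more than half of the vertices, so the minority side of a vote contains at most one ball.
  Hence the graphic rule is the majority plus a sum of one correction per ball. The influence
  of \<open>i\<close> on a monotone rule is linear in the rule, and by symmetry of the product measure the
  contribution of a ball depends only on whether it contains \<open>i\<close>; each \<open>i\<close> lies in exactly \<open>d + 1\<close>
  balls, so all influences agree. Finally the balls are exactly the winning coalitions of size
  \<open>d + 1\<close>, so an automorphism of the rule permutes them.
\<close>

section \<open>Points of the cube\<close>

lemma finite_cube: "finite (cube n)"
  unfolding cube_def by (intro finite_PiE) auto

lemma cube_val: "x \<in> cube n \<Longrightarrow> i \<in> {1..n} \<Longrightarrow> x i = -1 \<or> x i = 1"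
  unfolding cube_def by (drule (1) PiE_mem) simp

lemma cubeI:
  "(\<And>i. i \<in> {1..n} \<Longrightarrow> x i = -1 \<or> x i = 1) \<Longrightarrow> (\<And>i. i \<notin> {1..n} \<Longrightarrow> x i = undefined) \<Longrightarrow>
    x \<in> cube n"
  unfolding cube_def by (rule PiE_I) simp_all

lemma cube_undefined: "x \<in> cube n \<Longrightarrow> i \<notin> {1..n} \<Longrightarrow> x i = undefined"
  unfolding cube_def by (rule PiE_arb)

lemma flip_cube:
  assumes "x \<in> cube n" "i \<in> {1..n}"
  shows "flip i x \<in> cube n"
proof (rule cubeI)
  fix k assume "k \<in> {1..n}"
  then show "flip i x k = -1 \<or> flip i x k = 1"
    using cube_val[OF assms(1), of k] by (auto simp: flip_def)
next
  fix k assume "k \<notin> {1..n}"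
  then show "flip i x k = undefined"
    using cube_undefined[OF assms(1), of k] assms(2) by (auto simp: flip_def)
qed

lemma neg_cube:
  assumes "x \<in> cube n"
  shows "(\<lambda>i\<in>{1..n}. - x i) \<in> cube n"
proof (rule cubeI)
  fix k assume "k \<in> {1..n}"
  then show "(\<lambda>i\<in>{1..n}. - x i) k = -1 \<or> (\<lambda>i\<in>{1..n}. - x i) k = 1"
    using cube_val[OF assms, of k] by auto
qed auto

lemma comp_cube:
  assumes "\<sigma> permutes {1..n}" "x \<in> cube n"
  shows "x \<circ> \<sigma> \<in> cube n"
proof (rule cubeI)
  fix i assume "i \<in> {1..n}"
  then have "\<sigma> i \<in> {1..n}" using permutes_in_image[OF assms(1)] by blast
  then show "(x \<circ> \<sigma>) i = -1 \<or> (x \<circ> \<sigma>) i = 1" using cube_val[OF assms(2)] by simp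
next
  fix i assume i: "i \<notin> {1..n}"
  then show "(x \<circ> \<sigma>) i = undefined"
    using permutes_not_in[OF assms(1) i] cube_undefined[OF assms(2) i] by simp
qed

lemma flip_comp:
  assumes "\<sigma> permutes {1..n}"
  shows "flip i (x \<circ> \<sigma>) = flip (\<sigma> i) x \<circ> \<sigma>"
proof
  fix k
  have "k = i \<longleftrightarrow> \<sigma> k = \<sigma> i" using permutes_inj[OF assms] by (simp add: inj_eq)
  then show "flip i (x \<circ> \<sigma>) k = (flip (\<sigma> i) x \<circ> \<sigma>) k" by (auto simp: flip_def)
qed

lemma bij_betw_comp_cube:
  assumes "\<sigma> permutes {1..n}"
  shows "bij_betw (\<lambda>x. x \<circ> \<sigma>) (cube n) (cube n)"
proof (rule bij_betw_byWitness[where f' = "\<lambda>x. x \<circ> inv \<sigma>"])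
  show "\<forall>x\<in>cube n. x \<circ> \<sigma> \<circ> inv \<sigma> = x" "\<forall>x\<in>cube n. x \<circ> inv \<sigma> \<circ> \<sigma> = x"
    using permutes_inv_o[OF assms] by (auto simp: comp_assoc)
  show "(\<lambda>x. x \<circ> \<sigma>) ` cube n \<subseteq> cube n" using comp_cube[OF assms] by blast
  show "(\<lambda>x. x \<circ> inv \<sigma>) ` cube n \<subseteq> cube n" using comp_cube[OF permutes_inv[OF assms]] by blast
qed

lemma cube_card_split:
  assumes "x \<in> cube n"
  shows "card {i\<in>{1..n}. x i = 1} + card {i\<in>{1..n}. x i = -1} = n"
proof -
  have "card ({i\<in>{1..n}. x i = 1} \<union> {i\<in>{1..n}. x i = -1}) =
      card {i\<in>{1..n}. x i = 1} + card {i\<in>{1..n}. x i = -1}"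
    by (rule card_Un_disjoint) auto
  moreover have "{i\<in>{1..n}. x i = 1} \<union> {i\<in>{1..n}. x i = -1} = {1..n}"
    using cube_val[OF assms] by blast
  ultimately show ?thesis by simp
qed

section \<open>Majority\<close>

lemma maj_val: "maj n x = -1 \<or> maj n x = 1"
  by (simp add: maj_def)

lemma maj_eq_1_iff:
  assumes "x \<in> cube n" "odd n"
  shows "maj n x = 1 \<longleftrightarrow> n < 2 * card {i\<in>{1..n}. x i = 1}"
  using cube_card_split[OF assms(1)] unfolding maj_def by auto

text \<open>Oddness excludes a tie, so the voters against the majority value are strictly fewer than
  half.\<close>

lemma card_minority:
  assumes "x \<in> cube n" "odd n"
  shows "2 * card {i\<in>{1..n}. x i = - maj n x} < n"
proof -
  have "n \<noteq> 2 * card {i\<in>{1..n}. x i = 1}" using assms(2) by (metis dvd_triv_left)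
  then show ?thesis
    using cube_card_split[OF assms(1)] maj_val[of n x] maj_eq_1_iff[OF assms] by auto
qed

lemma maj_neg:
  assumes "x \<in> cube n" "odd n"
  shows "maj n (\<lambda>i\<in>{1..n}. - x i) = - maj n x"
proof -
  have "{i\<in>{1..n}. (\<lambda>i\<in>{1..n}. - x i) i = 1} = {i\<in>{1..n}. x i = -1}"
    "{i\<in>{1..n}. (\<lambda>i\<in>{1..n}. - x i) i = -1} = {i\<in>{1..n}. x i = 1}"
    by auto
  moreover have "card {i\<in>{1..n}. x i = 1} \<noteq> card {i\<in>{1..n}. x i = -1}"
    using cube_card_split[OF assms(1)] assms(2) by (metis even_add)
  ultimately show ?thesis by (auto simp: maj_def)
qed

lemma maj_mono:
  assumes "x \<in> cube n" "x' \<in> cube n" "odd n" "\<forall>i\<in>{1..n}. x i \<ge> x' i" "maj n x' = 1"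
  shows "maj n x = 1"
proof -
  have "{i\<in>{1..n}. x' i = 1} \<subseteq> {i\<in>{1..n}. x i = 1}"
  proof
    fix i assume "i \<in> {i\<in>{1..n}. x' i = 1}"
    then show "i \<in> {i\<in>{1..n}. x i = 1}"
      using assms(4) cube_val[OF assms(1), of i] by fastforce
  qed
  then have "card {i\<in>{1..n}. x' i = 1} \<le> card {i\<in>{1..n}. x i = 1}"
    by (intro card_mono) auto
  then show ?thesis using assms maj_eq_1_iff by fastforce
qed

lemma maj_comp:
  assumes "\<sigma> permutes {1..n}"
  shows "maj n (x \<circ> \<sigma>) = maj n x"
proof -
  have "card {i\<in>{1..n}. (x \<circ> \<sigma>) i = y} = card {i\<in>{1..n}. x i = y}" for y
  proof (rule bij_betw_same_card)
    show "bij_betw \<sigma> {i\<in>{1..n}. (x \<circ> \<sigma>) i = y} {i\<in>{1..n}. x i = y}"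
      unfolding bij_betw_def
    proof
      show "inj_on \<sigma> {i\<in>{1..n}. (x \<circ> \<sigma>) i = y}"
        using permutes_inj[OF assms] by (rule inj_on_subset) simp
      show "\<sigma> ` {i\<in>{1..n}. (x \<circ> \<sigma>) i = y} = {i\<in>{1..n}. x i = y}"
        using permutes_in_image[OF assms] permutes_surj[OF assms]
        by (auto simp: image_iff) (metis permutes_def assms)
    qed
  qed
  then show ?thesis by (simp add: maj_def)
qed

section \<open>Symmetry of product measures\<close>

lemma pmf_iid:
  assumes "x \<in> cube n"
  shows "pmf (iid n p) x = (\<Prod>i\<in>{1..n}. pmf p (x i))"
  using assms unfolding iid_def cube_def by (subst pmf_Pi') (auto simp: PiE_iff extensional_def)

lemma pmf_iid_comp:
  assumes "\<sigma> permutes {1..n}" "x \<in> cube n"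
  shows "pmf (iid n p) (x \<circ> \<sigma>) = pmf (iid n p) x"
  using prod.permute[OF assms(1), of "\<lambda>i. pmf p (x i)"]
  by (simp add: pmf_iid[OF assms(2)] pmf_iid[OF comp_cube[OF assms]] o_def[of "\<lambda>i. pmf p (x i)"])

lemma set_pmf_iid:
  assumes "set_pmf p \<subseteq> {-1, 1}"
  shows "set_pmf (iid n p) \<subseteq> cube n"
  using assms unfolding iid_def cube_def
  by (subst set_Pi_pmf) (auto simp: PiE_dflt_def PiE_iff extensional_def)

text \<open>The coordinates share one law, so composing with \<open>\<sigma>\<close> is a bijection
  of the cube that preserves point masses.\<close>

lemma sum_iid_comp:
  assumes "\<sigma> permutes {1..n}"
  shows "(\<Sum>x\<in>cube n. pmf (iid n p) x * f (x \<circ> \<sigma>)) = (\<Sum>x\<in>cube n. pmf (iid n p) x * f x)"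
  using sum.reindex_bij_betw[OF bij_betw_comp_cube[OF assms], of "\<lambda>x. pmf (iid n p) x * f x"]
  by (simp add: pmf_iid_comp[OF assms] cong: sum.cong)

text \<open>Monotonicity is what makes the influence linear in the rule.\<close>

lemma influence_monotone:
  assumes "set_pmf p \<subseteq> {-1, 1}" "i \<in> {1..n}" "monotone_rule n \<Phi>"
    and val: "\<And>x. x \<in> cube n \<Longrightarrow> \<Phi> x = -1 \<or> \<Phi> x = 1"
  shows "influence (iid n p) i \<Phi> =
    (\<Sum>x\<in>cube n. pmf (iid n p) x * real_of_int (x i * (\<Phi> x - \<Phi> (flip i x)))) / 2"
proof -
  let ?D = "{x. \<Phi> x \<noteq> \<Phi> (flip i x)}"
  \<comment> \<open>The measure has no mass off the cube; intersecting with it turns the probability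
    into a finite sum.\<close>
  have "influence (iid n p) i \<Phi> = measure_pmf.prob (iid n p) (?D \<inter> cube n)"
    unfolding influence_def using set_pmf_iid[OF assms(1)]
    by (intro measure_prob_cong_0) (auto simp: subset_iff set_pmf_iff)
  also have "\<dots> = (\<Sum>x\<in>?D \<inter> cube n. pmf (iid n p) x)"
    by (rule measure_measure_pmf_finite) (simp add: finite_cube)
  also have "\<dots> = (\<Sum>x\<in>cube n. if x \<in> ?D then pmf (iid n p) x else 0)"
    by (simp only: sum.inter_restrict[OF finite_cube, symmetric] Int_commute)
  also have "\<dots> = (\<Sum>x\<in>cube n. pmf (iid n p) x * real_of_int (x i * (\<Phi> x - \<Phi> (flip i x))) / 2)"
  proof (rule sum.cong)
    fix x assume x: "x \<in> cube n"
    have f: "flip i x \<in> cube n" using flip_cube[OF x assms(2)] .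
    have le: "\<Phi> (flip i x) \<le> \<Phi> x" if "x i = 1"
      using assms(3) x f that unfolding monotone_rule_def by (auto simp: flip_def)
    have ge: "\<Phi> x \<le> \<Phi> (flip i x)" if "x i = -1"
      using assms(3) x f that unfolding monotone_rule_def by (auto simp: flip_def)
    \<comment> \<open>By monotonicity the jump has the sign of \<open>x i\<close>, so the product is
      2 where \<open>i\<close> is pivotal and 0 elsewhere.\<close>
    show "(if x \<in> ?D then pmf (iid n p) x else 0) =
        pmf (iid n p) x * real_of_int (x i * (\<Phi> x - \<Phi> (flip i x))) / 2"
      using cube_val[OF x assms(2)] val[OF x] val[OF f] le ge by auto
  qed simp
  finally show ?thesis by (simp add: sum_divide_distrib)
qed

section \<open>Permutations carrying sets and pointed sets to one another\<close>

lemma permutes_image_eq: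
  assumes "finite A" "S \<subseteq> A" "T \<subseteq> A" "card S = card T"
  obtains \<sigma> where "\<sigma> permutes A" "\<sigma> ` S = T"
proof -
  have fin: "finite S" "finite T" using assms finite_subset by auto
  have "card (A - S) = card (A - T)"
    using assms fin by (simp add: card_Diff_subset)
  then obtain f g where f: "bij_betw f S T" and g: "bij_betw g (A - S) (A - T)"
    using finite_same_card_bij[OF fin assms(4)] finite_same_card_bij[of "A - S" "A - T"] assms(1)
    by auto
  \<comment> \<open>The complements are equinumerous too, so \<open>f\<close> and \<open>g\<close>
    glue to a permutation of \<open>A\<close>.\<close>
  define \<sigma> where "\<sigma> x = (if x \<in> S then f x else if x \<in> A then g x else x)" for x
  have s: "bij_betw \<sigma> S T" "bij_betw \<sigma> (A - S) (A - T)"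
    using f g by (auto simp: \<sigma>_def bij_betw_def inj_on_def)
  have "bij_betw \<sigma> (S \<union> (A - S)) (T \<union> (A - T))"
    by (rule bij_betw_combine[OF s]) auto
  then have "bij_betw \<sigma> A A" using assms by (simp add: Un_absorb1)
  then have "\<sigma> permutes A"
    by (rule bij_imp_permutes) (use assms in \<open>auto simp: \<sigma>_def\<close>)
  then show thesis using that s(1) by (auto simp: bij_betw_def)
qed

text \<open>After \<open>S\<close> is moved onto \<open>T\<close>, a transposition takes the image
  of \<open>i\<close> to \<open>j\<close>. Both points lie in \<open>T\<close> or both lie outside
  it, so \<open>T\<close> is kept.\<close>

lemma permutes_point_image_eq:
  assumes "finite A" "S \<subseteq> A" "T \<subseteq> A" "card S = card T" "i \<in> A" "j \<in> A" "i \<in> S \<longleftrightarrow> j \<in> T"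
  obtains \<sigma> where "\<sigma> permutes A" "\<sigma> i = j" "\<sigma> ` S = T"
proof -
  obtain \<rho> where \<rho>: "\<rho> permutes A" "\<rho> ` S = T"
    using permutes_image_eq[OF assms(1-4)] by blast
  define \<tau> where "\<tau> = Transposition.transpose (\<rho> i) j"
  have mem: "\<rho> i \<in> A" "\<rho> i \<in> T \<longleftrightarrow> j \<in> T"
    using permutes_in_image[OF \<rho>(1), of i] inj_image_mem_iff[OF permutes_inj[OF \<rho>(1)], of i S]
      \<rho>(2) assms by simp_all
  have "\<tau> permutes A" unfolding \<tau>_def using mem assms by (intro permutes_swap_id)
  moreover have "\<tau> ` T = T"
    unfolding \<tau>_def using mem(2) by (cases "j \<in> T") (auto simp: Transposition.transpose_def image_iff)
  ultimately show thesis
    using that[of "\<tau> \<circ> \<rho>"] \<rho> by (auto simp: permutes_compose \<tau>_def image_comp[symmetric])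
qed

section \<open>Voting rules from an intersecting family\<close>

text \<open>To be used with the balls of radius 1 and \<open>m = d + 1\<close>. \<open>B_int\<close>
  prevents conflicting unanimities, \<open>m_small\<close> makes a single member a minority,
  \<open>B_un\<close> keeps two members from fitting into the minority, and \<open>B_deg\<close>
  puts all voters on an equal footing.\<close>

locale ball_family =
  fixes n m :: nat and B :: "nat \<Rightarrow> nat set"
  assumes odd_n: "odd n"
    and B_sub: "v \<in> {1..n} \<Longrightarrow> B v \<subseteq> {1..n}"
    and card_B: "v \<in> {1..n} \<Longrightarrow> card (B v) = m"
    and m_pos: "0 < m"
    and m_small: "2 * m < n"
    and B_int: "u \<in> {1..n} \<Longrightarrow> v \<in> {1..n} \<Longrightarrow> B u \<inter> B v \<noteq> {}"
    and B_un: "u \<in> {1..n} \<Longrightarrow> v \<in> {1..n} \<Longrightarrow> u \<noteq> v \<Longrightarrow> n < 2 * card (B u \<union> B v)"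
    and B_deg: "i \<in> {1..n} \<Longrightarrow> card {v\<in>{1..n}. i \<in> B v} = m"
begin

definition unan :: "(nat \<Rightarrow> int) \<Rightarrow> int \<Rightarrow> bool" where
  "unan x y \<longleftrightarrow> (\<exists>v\<in>{1..n}. \<forall>i\<in>B v. x i = y)"

text \<open>The graphic rule with its definite description resolved; by \<open>unan_unique\<close>
  the order of the two tests is immaterial.\<close>

definition rule :: "(nat \<Rightarrow> int) \<Rightarrow> int" where
  "rule = (\<lambda>x\<in>cube n. if unan x 1 then 1 else if unan x (-1) then -1 else maj n x)"

lemma unan_unique: "unan x y \<Longrightarrow> unan x z \<Longrightarrow> y = z"
  unfolding unan_def using B_int by fast

lemma rule_unan: "x \<in> cube n \<Longrightarrow> unan x y \<Longrightarrow> y = -1 \<or> y = 1 \<Longrightarrow> rule x = y"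
  using unan_unique[of x 1 "-1"] by (auto simp: rule_def)

lemma rule_val: "x \<in> cube n \<Longrightarrow> rule x = -1 \<or> rule x = 1"
  using maj_val[of n x] by (auto simp: rule_def)

lemma rule_in_voting_rules: "rule \<in> voting_rules n"
  unfolding voting_rules_def
proof (rule PiE_I)
  fix x assume "x \<in> cube n"
  then show "rule x \<in> {-1, 1}" using rule_val[of x] by simp
qed (simp add: rule_def)

lemma unan_neg: "unan (\<lambda>i\<in>{1..n}. - x i) y \<longleftrightarrow> unan x (- y)"
proof -
  have "(\<lambda>i\<in>{1..n}. - x i) i = y \<longleftrightarrow> x i = - y" if "v \<in> {1..n}" "i \<in> B v" for v i
  proof -
    have "i \<in> {1..n}" using that B_sub by blast
    then show ?thesis by (simp only: restrict_apply if_True) linarith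
  qed
  then show ?thesis unfolding unan_def by blast
qed

lemma rule_odd: "odd_rule n rule"
  unfolding odd_rule_def
proof
  fix x assume x: "x \<in> cube n"
  define y where "y = (\<lambda>i\<in>{1..n}. - x i)"
  have y: "y \<in> cube n" "maj n y = - maj n x" "unan y 1 \<longleftrightarrow> unan x (-1)" "unan y (-1) \<longleftrightarrow> unan x 1"
    using neg_cube[OF x] maj_neg[OF x odd_n] unan_neg[of x 1] unan_neg[of x "-1"]
    unfolding y_def by simp_all
  have "\<not> (unan x 1 \<and> unan x (-1))" using unan_unique[of x 1 "-1"] by auto
  then have "rule y = - rule x" using x y by (auto simp: rule_def)
  then show "rule (\<lambda>i\<in>{1..n}. - x i) = - rule x" by (simp add: y_def)
qed

lemma rule_monotone: "monotone_rule n rule"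
  unfolding monotone_rule_def
proof (intro ballI impI)
  fix x x' assume x: "x \<in> cube n" and x': "x' \<in> cube n" and ge: "\<forall>i\<in>{1..n}. x i \<ge> x' i"
  \<comment> \<open>Raising votes keeps every unanimity for 1 and creates none for -1.\<close>
  have up: "unan x 1" if u: "unan x' 1"
  proof -
    obtain v where v: "v \<in> {1..n}" "\<forall>i\<in>B v. x' i = 1" using u unfolding unan_def by blast
    have "x i = 1" if i: "i \<in> B v" for i
    proof -
      have "i \<in> {1..n}" using i B_sub[OF v(1)] by blast
      then show ?thesis using ge v(2) i cube_val[OF x, of i] by fastforce
    qed
    then show ?thesis using v(1) unfolding unan_def by blast
  qed
  have down: "unan x' (-1)" if u: "unan x (-1)"
  proof -
    obtain v where v: "v \<in> {1..n}" "\<forall>i\<in>B v. x i = -1" using u unfolding unan_def by blast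
    have "x' i = -1" if i: "i \<in> B v" for i
    proof -
      have "i \<in> {1..n}" using i B_sub[OF v(1)] by blast
      then show ?thesis using ge v(2) i cube_val[OF x', of i] by fastforce
    qed
    then show ?thesis using v(1) unfolding unan_def by blast
  qed
  show "rule x' \<le> rule x"
    using maj_mono[OF x x' odd_n ge] maj_val[of n x] maj_val[of n x'] up down x x'
    by (auto simp: rule_def)
qed

section \<open>The rule as majority plus corrections\<close>

text \<open>The change from the majority value to its opposite, made when \<open>S\<close> votes
  unanimously against the majority. Unanimity with the majority calls for no change.\<close>

definition correction :: "(nat \<Rightarrow> int) \<Rightarrow> nat set \<Rightarrow> int" where
  "correction x S = (if \<forall>i\<in>S. x i = - maj n x then - 2 * maj n x else 0)"

text \<open>
  The minority has fewer than \<open>n / 2\<close> voters and so cannot cover two members of the family: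
  at most one summand is nonzero.
\<close>

lemma rule_eq_sum:
  assumes x: "x \<in> cube n"
  shows "rule x = maj n x + (\<Sum>v\<in>{1..n}. correction x (B v))"
proof (cases "unan x (- maj n x)")
  case True
  then obtain v where v: "v \<in> {1..n}" "\<forall>i\<in>B v. x i = - maj n x" by (auto simp: unan_def)
  have uniq: "w = v" if w: "w \<in> {1..n}" "\<forall>i\<in>B w. x i = - maj n x" for w
  proof (rule ccontr)
    assume "w \<noteq> v"
    have "B w \<union> B v \<subseteq> {i\<in>{1..n}. x i = - maj n x}" using v w B_sub by blast
    then have "card (B w \<union> B v) \<le> card {i\<in>{1..n}. x i = - maj n x}"
      by (intro card_mono) auto
    then show False using B_un[OF w(1) v(1) \<open>w \<noteq> v\<close>] card_minority[OF x odd_n] by linarith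
  qed
  have "(\<Sum>w\<in>{1..n}. correction x (B w)) = (\<Sum>w\<in>{1..n}. if w = v then - 2 * maj n x else 0)"
  proof (rule sum.cong)
    fix w assume w: "w \<in> {1..n}"
    show "correction x (B w) = (if w = v then - 2 * maj n x else 0)"
      using uniq[OF w] v(2) unfolding correction_def by (cases "w = v") auto
  qed simp
  also have "\<dots> = - 2 * maj n x" using v by simp
  finally show ?thesis using rule_unan[OF x True] maj_val[of n x] by auto
next
  case False
  then have "(\<Sum>w\<in>{1..n}. correction x (B w)) = 0"
    by (intro sum.neutral) (auto simp: correction_def unan_def)
  moreover have "rule x = maj n x"
    using False x maj_val[of n x] unfolding rule_def by auto
  ultimately show ?thesis by simp
qed

section \<open>Influences, split into a majority part and one part per ball\<close>

lemma correction_comp: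
  assumes "\<sigma> permutes {1..n}"
  shows "correction (x \<circ> \<sigma>) S = correction x (\<sigma> ` S)"
  by (simp add: correction_def maj_comp[OF assms])

text \<open>This and \<open>ball_part\<close> are the summands of twice the influence of
  \<open>i\<close>, as the formula of \<open>influence_monotone\<close> is linear in the
  rule.\<close>

definition maj_part :: "int pmf \<Rightarrow> nat \<Rightarrow> real" where
  "maj_part p i =
    (\<Sum>x\<in>cube n. pmf (iid n p) x * real_of_int (x i * (maj n x - maj n (flip i x))))"

definition ball_part :: "int pmf \<Rightarrow> nat \<Rightarrow> nat set \<Rightarrow> real" where
  "ball_part p i S =
    (\<Sum>x\<in>cube n. pmf (iid n p) x * real_of_int (x i * (correction x S - correction (flip i x) S)))"

lemma maj_part_permute:
  assumes "\<sigma> permutes {1..n}"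
  shows "maj_part p (\<sigma> i) = maj_part p i"
  using sum_iid_comp[OF assms, of p "\<lambda>x. real_of_int (x i * (maj n x - maj n (flip i x)))"]
  by (simp add: maj_part_def flip_comp[OF assms] maj_comp[OF assms])

text \<open>Relabelling voters preserves the measure and the majority, and carries the pair
  \<open>i\<close>, \<open>S\<close> to its image.\<close>

lemma ball_part_permute:
  assumes "\<sigma> permutes {1..n}"
  shows "ball_part p (\<sigma> i) (\<sigma> ` S) = ball_part p i S"
  using sum_iid_comp[OF assms, of p
      "\<lambda>x. real_of_int (x i * (correction x S - correction (flip i x) S))"]
  by (simp add: ball_part_def flip_comp[OF assms] correction_comp[OF assms])

text \<open>Monotonicity is applied to \<open>rule\<close> as a whole; only then is the sum
  \<open>rule_eq_sum\<close> inserted at \<open>x\<close> and \<open>flip i x\<close>.\<close>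

lemma influence_rule:
  assumes "set_pmf p \<subseteq> {-1, 1}" "i \<in> {1..n}"
  shows "influence (iid n p) i rule = (maj_part p i + (\<Sum>v\<in>{1..n}. ball_part p i (B v))) / 2"
proof -
  have "(\<Sum>x\<in>cube n. pmf (iid n p) x * real_of_int (x i * (rule x - rule (flip i x)))) =
    (\<Sum>x\<in>cube n. pmf (iid n p) x * real_of_int (x i * (maj n x - maj n (flip i x))) +
      (\<Sum>v\<in>{1..n}. pmf (iid n p) x *
        real_of_int (x i * (correction x (B v) - correction (flip i x) (B v)))))"
  proof (rule sum.cong)
    fix x assume x: "x \<in> cube n"
    have "rule x - rule (flip i x) = (maj n x - maj n (flip i x)) +
        (\<Sum>v\<in>{1..n}. correction x (B v) - correction (flip i x) (B v))"
      using rule_eq_sum[OF x] rule_eq_sum[OF flip_cube[OF x assms(2)]]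
      by (simp add: sum_subtractf)
    then show "pmf (iid n p) x * real_of_int (x i * (rule x - rule (flip i x))) =
      pmf (iid n p) x * real_of_int (x i * (maj n x - maj n (flip i x))) +
      (\<Sum>v\<in>{1..n}. pmf (iid n p) x *
        real_of_int (x i * (correction x (B v) - correction (flip i x) (B v))))"
      by (simp add: distrib_left sum_distrib_left)
  qed simp
  also have "\<dots> = maj_part p i + (\<Sum>v\<in>{1..n}. ball_part p i (B v))"
    unfolding sum.distrib maj_part_def ball_part_def by (subst sum.swap) simp
  finally show ?thesis
    using influence_monotone[OF assms rule_monotone rule_val] by simp
qed

text \<open>Swapping \<open>i\<close> and \<open>j\<close> settles the majority part. By
  \<open>B_deg\<close> both lie in equally many members, so some \<open>\<pi>\<close> matches
  members containing \<open>i\<close> with members containing \<open>j\<close>, and the rest with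
  the rest; matched members contribute equally.\<close>

lemma rule_unbiased: "unbiased n rule"
  unfolding unbiased_def
proof (intro allI impI ballI)
  fix p :: "int pmf" and i j
  assume p: "set_pmf p \<subseteq> {-1, 1}" and i: "i \<in> {1..n}" and j: "j \<in> {1..n}"
  have "maj_part p i = maj_part p j"
    using maj_part_permute[OF permutes_swap_id[OF i j], of p i] by simp
  moreover have "(\<Sum>v\<in>{1..n}. ball_part p i (B v)) = (\<Sum>v\<in>{1..n}. ball_part p j (B v))"
  proof -
    have "card {v\<in>{1..n}. i \<in> B v} = card {v\<in>{1..n}. j \<in> B v}"
      using B_deg[OF i] B_deg[OF j] by simp
    then obtain \<pi> where \<pi>: "\<pi> permutes {1..n}"
        "\<pi> ` {v\<in>{1..n}. i \<in> B v} = {v\<in>{1..n}. j \<in> B v}"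
      using permutes_image_eq[of "{1..n}" "{v\<in>{1..n}. i \<in> B v}" "{v\<in>{1..n}. j \<in> B v}"]
      by blast
    have "ball_part p i (B v) = ball_part p j (B (\<pi> v))" if v: "v \<in> {1..n}" for v
    proof -
      have w: "\<pi> v \<in> {1..n}" using v permutes_in_image[OF \<pi>(1)] by blast
      have "i \<in> B v \<longleftrightarrow> v \<in> {v\<in>{1..n}. i \<in> B v}" using v by simp
      also have "\<dots> \<longleftrightarrow> \<pi> v \<in> {v\<in>{1..n}. j \<in> B v}"
        using \<pi>(2) inj_image_mem_iff[OF permutes_inj[OF \<pi>(1)]] by metis
      finally have "i \<in> B v \<longleftrightarrow> j \<in> B (\<pi> v)" using w by simp
      \<comment> \<open>\<open>\<sigma>\<close> is chosen afresh for each \<open>v\<close> and need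
        not preserve the family: it only relates one member to another.\<close>
      then obtain \<sigma> where "\<sigma> permutes {1..n}" "\<sigma> i = j" "\<sigma> ` B v = B (\<pi> v)"
        using permutes_point_image_eq[of "{1..n}" "B v" "B (\<pi> v)" i j]
          B_sub[OF v] B_sub[OF w] card_B[OF v] card_B[OF w] i j by auto
      then show ?thesis using ball_part_permute by metis
    qed
    then have "(\<Sum>v\<in>{1..n}. ball_part p i (B v)) = (\<Sum>v\<in>{1..n}. ball_part p j (B (\<pi> v)))"
      by (intro sum.cong) auto
    also have "\<dots> = (\<Sum>v\<in>{1..n}. ball_part p j (B v))"
      using sum.permute[OF \<pi>(1), of "\<lambda>v. ball_part p j (B v)"] by (simp add: comp_def)
    finally show ?thesis .
  qed
  ultimately show "influence (iid n p) i rule = influence (iid n p) j rule"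
    using influence_rule[OF p i] influence_rule[OF p j] by simp
qed

section \<open>Winning coalitions and automorphisms of the rule\<close>

lemma winning_B:
  assumes "v \<in> {1..n}"
  shows "winning_coalition n rule (B v)"
  unfolding winning_coalition_def
proof (intro conjI ballI impI)
  fix y :: int and x assume "y \<in> {-1, 1}" "x \<in> cube n" "\<forall>i\<in>B v. x i = y"
  then show "rule x = y" using rule_unan[of x y] assms unfolding unan_def by blast
qed (rule B_sub[OF assms])

definition point :: "nat set \<Rightarrow> nat \<Rightarrow> int" where
  "point S = (\<lambda>i\<in>{1..n}. if i \<in> S then 1 else -1)"

lemma point_cube: "point S \<in> cube n"
  by (auto simp: point_def cube_def)

text \<open>Since \<open>2 * m < n\<close>, the voters in \<open>S\<close> lose the majority vote,
  so 1 can win only through a member inside \<open>S\<close>, which then equals \<open>S\<close> by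
  size. Thus the rule determines the family.\<close>

lemma rule_point_iff:
  assumes "S \<subseteq> {1..n}" "card S = m"
  shows "rule (point S) = 1 \<longleftrightarrow> S \<in> B ` {1..n}"
proof
  assume "S \<in> B ` {1..n}"
  then have "unan (point S) 1" using B_sub by (force simp: unan_def point_def)
  then show "rule (point S) = 1" by (simp add: rule_unan point_cube)
next
  assume r: "rule (point S) = 1"
  have "{i\<in>{1..n}. point S i = 1} = S" using assms(1) by (auto simp: point_def split: if_splits)
  then have "maj n (point S) = -1"
    using maj_eq_1_iff[OF point_cube odd_n] maj_val[of n "point S"] assms(2) m_small by fastforce
  then have "unan (point S) 1" using r point_cube by (auto simp: rule_def split: if_splits)
  then obtain v where v: "v \<in> {1..n}" "\<forall>i\<in>B v. point S i = 1" by (auto simp: unan_def)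
  then have "B v \<subseteq> S" using B_sub[OF v(1)] by (force simp: point_def split: if_splits)
  then have "B v = S"
    using card_B[OF v(1)] assms finite_subset[OF assms(1)] by (intro card_subset_eq) auto
  then show "S \<in> B ` {1..n}" using v by blast
qed

text \<open>An automorphism fixes the value of the rule at relabelled indicator points, and by
  \<open>rule_point_iff\<close> these values single out the members.\<close>

lemma aut_rule_preserves:
  assumes "\<sigma> \<in> aut_rule n rule"
  shows "(\<lambda>S. \<sigma> ` S) ` B ` {1..n} = B ` {1..n}"
proof -
  have \<sigma>: "\<sigma> permutes {1..n}" and eq: "permute_rule n \<sigma> rule = rule"
    using assms by (auto simp: aut_rule_def)
  have inj: "inj_on (\<lambda>S. inv \<sigma> ` S) (B ` {1..n})"
    using permutes_inj[OF permutes_inv[OF \<sigma>]] by (auto simp: inj_on_def inj_image_eq_iff)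
  have "inv \<sigma> ` S \<in> B ` {1..n}" if S: "S \<in> B ` {1..n}" for S
  proof -
    have sub: "S \<subseteq> {1..n}" and card: "card S = m" using S B_sub card_B by blast+
    have "point S \<circ> \<sigma> = point (inv \<sigma> ` S)"
    proof
      fix i
      have "i \<in> inv \<sigma> ` S \<longleftrightarrow> \<sigma> i \<in> S"
        using permutes_inverses[OF \<sigma>] by (auto simp: image_iff) (metis)
      then show "(point S \<circ> \<sigma>) i = point (inv \<sigma> ` S) i"
        using permutes_in_image[OF \<sigma>, of i] by (simp add: point_def)
    qed
    \<comment> \<open>The two inverses in \<open>permute_rule\<close> and
      \<open>permute_point\<close> cancel, leaving composition with \<open>\<sigma>\<close>.\<close>
    moreover have "rule (point S \<circ> \<sigma>) = rule (point S)"
      using fun_cong[OF eq, of "point S"] permutes_inv_inv[OF \<sigma>]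
      by (simp add: permute_rule_def permute_point_def point_cube comp_def)
    ultimately have "rule (point (inv \<sigma> ` S)) = 1"
      using rule_point_iff[OF sub card] S by simp
    moreover have "inv \<sigma> ` S \<subseteq> {1..n}"
      using sub permutes_image[OF permutes_inv[OF \<sigma>]] by blast
    moreover have "card (inv \<sigma> ` S) = m"
      using card card_image[of "inv \<sigma>" S] permutes_inj[OF permutes_inv[OF \<sigma>]]
      by (metis inj_on_subset subset_UNIV)
    ultimately show ?thesis using rule_point_iff by blast
  qed
  \<comment> \<open>An injective map of a finite family into itself is onto.\<close>
  then have "(\<lambda>S. inv \<sigma> ` S) ` B ` {1..n} = B ` {1..n}"
    using inj by (intro endo_inj_surj) auto
  then have "(\<lambda>S. \<sigma> ` S) ` B ` {1..n} = (\<lambda>S. \<sigma> ` S) ` (\<lambda>S. inv \<sigma> ` S) ` B ` {1..n}"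
    by simp
  also have "\<dots> = B ` {1..n}"
    by (simp add: image_image permutes_inverses(1)[OF \<sigma>])
  finally show ?thesis .
qed

end

section \<open>Balls in graphs\<close>

text \<open>The infimum of a nonempty set of lengths is attained, and that of the empty set is
  \<open>\<infinity>\<close>, which is above \<open>r\<close>.\<close>

lemma gdist_le_iff: "gdist E u v \<le> enat r \<longleftrightarrow> (\<exists>k\<le>r. (u, v) \<in> {(a, b). {a, b} \<in> E} ^^ k)"
  (is "_ \<longleftrightarrow> (\<exists>k\<le>r. ?P k)")
proof
  assume le: "gdist E u v \<le> enat r"
  have ne: "{k. ?P k} \<noteq> {}"
  proof
    assume "{k. ?P k} = {}"
    then have "gdist E u v = \<infinity>" unfolding gdist_def by (simp add: top_enat_def)
    then show False using le by simp
  qed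
  then have "gdist E u v \<in> enat ` {k. ?P k}"
    unfolding gdist_def using wellorder_InfI[of _ "enat ` {k. ?P k}"] by blast
  then show "\<exists>k\<le>r. ?P k" using le by auto
next
  assume "\<exists>k\<le>r. ?P k"
  then obtain k where "k \<le> r" "?P k" by blast
  then have "gdist E u v \<le> enat k" unfolding gdist_def by (intro INF_lower) simp
  then show "gdist E u v \<le> enat r" using \<open>k \<le> r\<close> by (meson enat_ord_simps(1) order_trans)
qed

lemma gdist_0: "gdist E u v = 0 \<longleftrightarrow> u = v"
  using gdist_le_iff[of E u v 0] by (auto simp: zero_enat_def[symmetric])

lemma gdist_le_1: "gdist E u v \<le> 1 \<longleftrightarrow> u = v \<or> {u, v} \<in> E"
proof -
  have "(\<exists>k\<le>1. (u, v) \<in> {(a, b). {a, b} \<in> E} ^^ k) \<longleftrightarrow> u = v \<or> {u, v} \<in> E"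
    by (auto simp: le_Suc_eq)
  then show ?thesis using gdist_le_iff[of E u v 1] by (simp add: one_enat_def)
qed

lemma gball_1: "gball n E 1 v = {u\<in>{1..n}. u = v \<or> {u, v} \<in> E}"
  by (simp add: gball_def gdist_le_1)

lemma gball_1_sym:
  "u \<in> {1..n} \<Longrightarrow> v \<in> {1..n} \<Longrightarrow> u \<in> gball n E 1 v \<longleftrightarrow> v \<in> gball n E 1 u"
  by (auto simp: gball_1 insert_commute)

lemma gdist_le_2:
  assumes "gball n E 1 u \<inter> gball n E 1 v \<noteq> {}"
  shows "gdist E u v \<le> 2"
proof -
  obtain w where w: "w = u \<or> {u, w} \<in> E" "w = v \<or> {w, v} \<in> E"
    using assms by (auto simp: gball_1 insert_commute)
  let ?R = "{(a, b). {a, b} \<in> E}"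
  \<comment> \<open>The common point may be an end itself, so each half of the walk has length 0 or
    1.\<close>
  have "(u, w) \<in> ?R ^^ (if w = u then 0 else 1)" "(w, v) \<in> ?R ^^ (if w = v then 0 else 1)"
    using w by auto
  then have "(u, v) \<in> ?R ^^ ((if w = u then 0 else 1) + (if w = v then 0 else 1))"
    by (auto simp only: relpow_add)
  then have "gdist E u v \<le> enat 2"
    unfolding gdist_le_iff by (intro exI conjI) auto
  then show ?thesis by (simp add: numeral_eq_enat)
qed

text \<open>Meeting balls bound the diameter by 2, and the distinct vertices 1 and 2 make it at
  least 1; half of either value rounds up to 1.\<close>

lemma grad_eq_1:
  assumes "2 \<le> n"
    and "\<And>u v. u \<in> {1..n} \<Longrightarrow> v \<in> {1..n} \<Longrightarrow> gball n E 1 u \<inter> gball n E 1 v \<noteq> {}"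
  shows "grad n E = 1"
proof -
  have "gdiam n E \<le> 2"
    unfolding gdiam_def using assms(2) gdist_le_2 by (intro SUP_least) blast
  then obtain k where k: "gdiam n E = enat k" "k \<le> 2"
    by (cases "gdiam n E") (auto simp: numeral_eq_enat)
  have "gdist E 1 2 \<le> gdiam n E"
    unfolding gdiam_def using assms(1)
    by (intro order_trans[OF _ SUP_upper[of 1]] SUP_upper) auto
  moreover have "gdist E 1 2 \<noteq> 0" by (simp add: gdist_0)
  ultimately have "k \<noteq> 0" using k(1) by (metis le_zero_eq zero_enat_def)
  then have "k = 1 \<or> k = 2" using k by auto
  moreover have "\<lceil>1 / 2 :: real\<rceil> = 1" by (simp add: ceiling_eq_iff)
  ultimately show ?thesis using k(1) by (auto simp: grad_def one_enat_def)
qed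

lemma card_gball_1:
  assumes "simple_graph n E" "regular n E d" "v \<in> {1..n}"
  shows "card (gball n E 1 v) = d + 1"
proof -
  \<comment> \<open>There are no loops, so the centre adds one to its \<open>d\<close>
    neighbours.\<close>
  have "{v, v} \<notin> E" using assms(1) by (auto simp: simple_graph_def)
  moreover have "gball n E 1 v = insert v {u\<in>{1..n}. {u, v} \<in> E}"
    using assms(3) by (auto simp: gball_1)
  ultimately show ?thesis using assms by (auto simp: regular_def)
qed

lemma gball_1_permute_graph:
  assumes "\<sigma> permutes {1..n}"
  shows "gball n (permute_graph \<sigma> E) 1 (\<sigma> v) = \<sigma> ` gball n E 1 v"
proof -
  have inj: "inj \<sigma>" using permutes_inj[OF assms] .
  then have "inj (image \<sigma>)" by (simp add: inj_def inj_image_eq_iff)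
  then have edge: "{\<sigma> u, \<sigma> v} \<in> permute_graph \<sigma> E \<longleftrightarrow> {u, v} \<in> E" for u
    using inj_image_mem_iff[of "image \<sigma>" "{u, v}" E] by (simp add: permute_graph_def)
  show ?thesis
  proof (rule set_eqI)
    fix w
    obtain u where w: "w = \<sigma> u" using permutes_surj[OF assms] by (rule surjE)
    show "w \<in> gball n (permute_graph \<sigma> E) 1 (\<sigma> v) \<longleftrightarrow> w \<in> \<sigma> ` gball n E 1 v"
      using permutes_in_image[OF assms, of u]
      by (simp only: w gball_1 mem_Collect_eq edge inj_image_mem_iff[OF inj] inj_eq[OF inj])
  qed
qed

lemma gballs_1_permute_graph:
  assumes "\<sigma> permutes {1..n}"
  shows "gballs n (permute_graph \<sigma> E) 1 = (\<lambda>S. \<sigma> ` S) ` gballs n E 1"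
proof -
  have "gballs n (permute_graph \<sigma> E) 1 = gball n (permute_graph \<sigma> E) 1 ` \<sigma> ` {1..n}"
    using permutes_image[OF assms] by (simp add: gballs_def)
  then show ?thesis
    by (simp add: gballs_def image_image gball_1_permute_graph[OF assms])
qed

text \<open>
  With \<open>\<delta> = d / n\<close>, two balls cover a fraction of about \<open>2\<delta> - \<delta>\<^sup>2 = 1 - (1 - \<delta>)\<^sup>2\<close> of the
  vertices, which exceeds \<open>1/2\<close> because \<open>0.293 > 1 - 1/\<surd>2\<close>.
\<close>

lemma two_balls_majority:
  fixes n d c e :: real
  assumes "100000 \<le> n" "0.293 * n - 2 \<le> d" "d \<le> n / 2" "e \<le> 0.001"
    and "c \<le> (1 + e) * d\<^sup>2 / n"
  shows "n < 2 * (2 * (d + 1) - c)"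
proof -
  have "(1 + e) * (d\<^sup>2 / n) \<le> 1.001 * (d\<^sup>2 / n)"
    using assms(1,4) by (intro mult_right_mono) auto
  then have "c \<le> 1.001 * d\<^sup>2 / n" using assms(5) by simp
  moreover have "1.001 * d\<^sup>2 / n < 2 * (d + 1) - n / 2"
  proof -
    \<comment> \<open>By convexity \<open>d * d\<close> lies below its chord between the endpoints
      \<open>0.293 * n - 2\<close> and \<open>n / 2\<close>.\<close>
    have "0 \<le> (d - (0.293 * n - 2)) * (n - 2 * d)"
      using assms by (intro mult_nonneg_nonneg) auto
    then have chord: "2000 * (d * d) \<le> 1586 * (n * d) - 4000 * d - 293 * (n * n) + 2000 * n"
      by (simp add: field_simps)
    \<comment> \<open>With the chord inserted, the goal is linear in \<open>d\<close> with positive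
      slope \<open>2 * n - 1.001 * (0.793 * n - 2)\<close>, the first factor here; so the lower
      endpoint is the worst case.\<close>
    have "0 \<le> (1.206207 * n + 2.002) * (d - (0.293 * n - 2))"
      using assms by (intro mult_nonneg_nonneg) auto
    then have slope: "0 \<le> 1206207000 * (n * d) - 353418651 * (n * n) + 1825828000 * n +
        2002000000 * d + 4004000000"
      by (simp add: field_simps)
    \<comment> \<open>At that endpoint about \<open>0.000065 * n * n\<close> is left over, which for
      such \<open>n\<close> outweighs the linear terms.\<close>
    have "100000 * n \<le> n * n" using assms(1) by (intro mult_right_mono) auto
    with chord slope have "1001 * (d * d) < 2000 * (n * d) + 2000 * n - 500 * (n * n)"
      using assms(1) by linarith
    then have "1.001 * d\<^sup>2 < (2 * (d + 1) - n / 2) * n"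
      by (simp add: field_simps power2_eq_square)
    then show ?thesis using assms(1) by (simp add: divide_less_eq)
  qed
  ultimately show ?thesis by simp
qed

text \<open>The lower bound on intersections makes balls meet; the upper bound, with the lower bound
  on \<open>d\<close>, makes unions large. The upper bound on \<open>d\<close> gives
  \<open>m_small\<close>.\<close>

lemma ball_family_gball:
  assumes E: "simple_graph n E" "regular n E d" and n: "odd n" "100000 \<le> n"
    and d: "\<lfloor>0.293 * real n\<rfloor> - 1 \<le> int d" "real d \<le> (real n - 3) / 2"
    and e: "e \<le> 0.001"
    and int: "\<And>u v. u \<in> {1..n} \<Longrightarrow> v \<in> {1..n} \<Longrightarrow> u \<noteq> v \<Longrightarrow>
      \<bar>real (card (gball n E 1 u \<inter> gball n E 1 v)) - (real d)\<^sup>2 / real n\<bar>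
        \<le> e * (real d)\<^sup>2 / real n"
  shows "ball_family n (d + 1) (gball n E 1)"
proof
  \<comment> \<open>Rounding down loses less than 1, and the hypothesis subtracts another 1.\<close>
  have lo: "0.293 * real n - 2 \<le> real d" using d(1) by linarith
  have pos: "0 < (real d)\<^sup>2 / real n" using lo n by simp
  have mid: "real d \<le> real n / 2" using d(2) by simp
  fix u v assume u: "u \<in> {1..n}" and v: "v \<in> {1..n}"
  show "gball n E 1 u \<inter> gball n E 1 v \<noteq> {}"
  proof (cases "u = v")
    case True
    then show ?thesis using u by (auto simp: gball_1)
  next
    case False
    \<comment> \<open>The error is at most a thousandth of the positive main term, so the
      intersection has positive size.\<close>
    have "e * ((real d)\<^sup>2 / real n) \<le> 0.001 * ((real d)\<^sup>2 / real n)"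
      using e pos by (intro mult_right_mono) auto
    then show ?thesis using int[OF u v False] pos by auto
  qed
  assume ne: "u \<noteq> v"
  let ?c = "card (gball n E 1 u \<inter> gball n E 1 v)"
  have "real ?c \<le> (1 + e) * (real d)\<^sup>2 / real n"
    using int[OF u v ne] by (simp add: abs_le_iff distrib_right add_divide_distrib)
  then have "real n < 2 * (2 * (real d + 1) - real ?c)"
    using two_balls_majority[OF _ lo mid e] n(2) by simp
  moreover have "2 * (d + 1) = card (gball n E 1 u \<union> gball n E 1 v) + ?c"
    using card_Un_Int[of "gball n E 1 u" "gball n E 1 v"] card_gball_1[OF E u] card_gball_1[OF E v]
    by (simp add: gball_def)
  then have "real (2 * (d + 1)) = real (card (gball n E 1 u \<union> gball n E 1 v) + ?c)"
    by (rule arg_cong)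
  then have "2 * (real d + 1) = real (card (gball n E 1 u \<union> gball n E 1 v)) + real ?c"
    by simp
  ultimately have "real n < real (2 * card (gball n E 1 u \<union> gball n E 1 v))" by simp
  then show "n < 2 * card (gball n E 1 u \<union> gball n E 1 v)" by (simp only: of_nat_less_iff)
next
  fix i assume i: "i \<in> {1..n}"
  \<comment> \<open>Adjacency is symmetric: the balls containing \<open>i\<close> are those centred
    in the ball of \<open>i\<close>.\<close>
  have "{v\<in>{1..n}. i \<in> gball n E 1 v} = gball n E 1 i"
    using gball_1_sym[OF i] by (auto simp: gball_1)
  then show "card {v\<in>{1..n}. i \<in> gball n E 1 v} = d + 1"
    using card_gball_1[OF E i] by simp
next
  have "real (2 * (d + 1)) < real n" using d(2) by simp
  then show "2 * (d + 1) < n" by (simp only: of_nat_less_iff)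
  show "gball n E 1 v \<subseteq> {1..n}" for v by (auto simp: gball_def)
qed (use n(1) card_gball_1[OF E] in simp_all)

section \<open>Back to the graphic rule\<close>

text \<open>Meeting balls force radius 1 and make the unanimous value unique, so \<open>THE\<close>
  returns it.\<close>

lemma graphic_rule_eq:
  assumes "ball_family n m (gball n E 1)"
  shows "graphic_rule n E = ball_family.rule n (gball n E 1)"
proof -
  interpret ball_family n m "gball n E 1" by fact
  have "grad n E = 1"
    using m_pos m_small B_int by (intro grad_eq_1) auto
  then have un: "ball_unanimous n E x y \<longleftrightarrow> y \<in> {-1, 1} \<and> unan x y" for x y
    by (simp add: ball_unanimous_def unan_def)
  have the: "(THE y. ball_unanimous n E x y) = y" if "ball_unanimous n E x y" for x y
    using that unan_unique by (intro the_equality) (auto simp: un)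
  show ?thesis
    unfolding graphic_rule_def rule_def
    using the unan_unique[of _ 1 "-1"] by (intro restrict_ext) (auto simp: un)
qed

text \<open>Automorphisms of the rule permute the balls and hence lie in
  \<open>aut_gballs n E\<close>, which is trivial.\<close>

lemma card_aut_graphic_rule:
  assumes "ball_family n m (gball n E 1)" "card (aut_gballs n E) = 1"
  shows "card (aut_rule n (graphic_rule n E)) = 1"
proof -
  interpret ball_family n m "gball n E 1" by fact
  have "id \<in> aut_gballs n E"
    by (simp add: aut_gballs_def permute_graph_def)
  then have single: "aut_gballs n E = {id}"
    using assms(2) by (auto simp: card_1_singleton_iff)
  have "\<sigma> \<in> aut_gballs n E" if "\<sigma> \<in> aut_rule n rule" for \<sigma>
  proof -
    have \<sigma>: "\<sigma> permutes {1..n}" using that by (simp add: aut_rule_def)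
    have "gballs n (permute_graph \<sigma> E) 1 = gballs n E 1"
      unfolding gballs_1_permute_graph[OF \<sigma>] gballs_def[of n E]
      by (rule aut_rule_preserves[OF that])
    then show ?thesis using \<sigma> by (simp add: aut_gballs_def)
  qed
  moreover have "id \<in> aut_rule n rule"
    by (auto simp: aut_rule_def permute_rule_def permute_point_def rule_def fun_eq_iff)
  ultimately have "aut_rule n rule = {id}" using single by auto
  then show ?thesis using graphic_rule_eq[OF assms(1)] by simp
qed

theorem theorem7:
  fixes \<epsilon> :: "nat \<Rightarrow> real"
  assumes "\<epsilon> \<longlonglongrightarrow> 0"
  shows "\<exists>N. \<forall>n\<ge>N. odd n \<longrightarrow> (\<forall>(E :: nat set set) (d :: nat).
      simple_graph n E \<longrightarrow> regular n E d \<longrightarrow>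
      \<lfloor>0.293 * real n\<rfloor> - 1 \<le> int d \<longrightarrow> real d \<le> (real n - 3) / 2 \<longrightarrow>
      card (aut_gballs n E) = 1 \<longrightarrow>
      (\<forall>u\<in>{1..n}. \<forall>v\<in>{1..n}. u \<noteq> v \<longrightarrow>
         \<bar>real (card (gball n E 1 u \<inter> gball n E 1 v)) - (real d)\<^sup>2 / real n\<bar>
           \<le> \<epsilon> n * (real d)\<^sup>2 / real n) \<longrightarrow>
      graphic_rule n E \<in> voting_rules n \<and>
      odd_rule n (graphic_rule n E) \<and>
      monotone_rule n (graphic_rule n E) \<and>
      unbiased n (graphic_rule n E) \<and>
      card (aut_rule n (graphic_rule n E)) = 1 \<and>
      (\<exists>S. winning_coalition n (graphic_rule n E) S \<and> card S = d + 1))"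
proof -
  \<comment> \<open>The tolerance 0.001, like the bound 100000 below, is the one required by
    \<open>two_balls_majority\<close>.\<close>
  have "\<forall>\<^sub>F n in sequentially. \<epsilon> n < 0.001"
    using assms by (rule order_tendstoD) simp
  then obtain N where N: "\<And>n. n \<ge> N \<Longrightarrow> \<epsilon> n < 0.001"
    by (auto simp: eventually_sequentially)
  show ?thesis
  proof (intro exI[of _ "max N 100000"] allI impI)
    fix n E d
    assume n: "n \<ge> max N 100000" "odd n" and E: "simple_graph n E" "regular n E d"
      and d: "\<lfloor>0.293 * real n\<rfloor> - 1 \<le> int d" "real d \<le> (real n - 3) / 2"
      and aut: "card (aut_gballs n E) = 1"
      and int: "\<forall>u\<in>{1..n}. \<forall>v\<in>{1..n}. u \<noteq> v \<longrightarrow>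
         \<bar>real (card (gball n E 1 u \<inter> gball n E 1 v)) - (real d)\<^sup>2 / real n\<bar>
           \<le> \<epsilon> n * (real d)\<^sup>2 / real n"
    have bf: "ball_family n (d + 1) (gball n E 1)"
      using ball_family_gball[OF E n(2) _ d, of "\<epsilon> n"] N[of n] n(1) int by simp
    then interpret ball_family n "d + 1" "gball n E 1" .
    have "1 \<in> {1..n}" using n(1) by simp
    then have "\<exists>S. winning_coalition n rule S \<and> card S = d + 1"
      using winning_B card_B by blast
    then show "graphic_rule n E \<in> voting_rules n \<and>
      odd_rule n (graphic_rule n E) \<and>
      monotone_rule n (graphic_rule n E) \<and>
      unbiased n (graphic_rule n E) \<and>
      card (aut_rule n (graphic_rule n E)) = 1 \<and>
      (\<exists>S. winning_coalition n (graphic_rule n E) S \<and> card S = d + 1)"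
      using rule_in_voting_rules rule_odd rule_monotone rule_unbiased
        card_aut_graphic_rule[OF bf aut] graphic_rule_eq[OF bf] by simp
  qed
qed

end
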